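(* For every $n\in\mathbb{N}$ and every $b\in(0,\infty)$, the five sets $\mathcal{Y}_b^{(n)}$, $\mathcal{A}_b^{(n)}$, $\mathcal{Y}_b^{(n)}\setminus\mathcal{A}_b^{(n)}$, $\mathcal{A}$ and $\mathcal{Y}_{\mathrm{conc}}$ are pairwise equinumerous (i.e. there is a bijection between any two of them).
   Context: $\mathbb{N}=\{1,2,\dots\}$. $\mathcal{Y}_{\mathrm{conc}}$ (the concave Young-functions) is the set of all functions $\Phi:[0,\infty)\to[0,\infty)$ of the form $\Phi(x)=\int_0^x\varphi(t)\,dt$, where $\varphi:(0,\infty)\to(0,\infty)$ is right-continuous, decreasing and integrable on every finite interval $(0,x)$, and $\Phi(\infty):=\lim_{x\to\infty}\Phi(x)=\infty$. Here "decreasing" is meant strictly, so every function in $\mathcal{Y}_{\mathrm{conc}}$ is strictly concave. $\mathcal{A}$ is the set of $\Phi\in\mathcal{Y}_{\mathrm{conc}}$ with $\int_1^\infty\frac{\varphi(t)}{t}\,dt<\infty$. For $b\in(0,\infty)$, $\mathcal{A}_b:=\{\Phi\in\mathcal{A}:\Phi(b)=b\}$ and $\mathcal{Y}_b:=\{\Phi\in\mathcal{Y}_{\mathrm{conc}}:\Phi(b)=b\}$. Set $\mathcal{A}_b^{(1)}=\mathcal{A}_b$, $\mathcal{Y}_b^{(1)}=\mathcal{Y}_b$. For $n\ge 2$ let $\mathcal{Y}_b^{CO(n)}=\{\Delta_1\circ\cdots\circ\Delta_n:\Delta_1,\dots,\Delta_n\in\mathcal{Y}_b\}$ and $\mathcal{A}_b^{CO(n)}=\{\Phi_1\circ\cdots\circ\Phi_n:\Phi_1,\dots,\Phi_n\in\mathcal{Y}_b\text{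 and }\Phi_j\in\mathcal{A}_b\text{ for some index }j\}$. For $n\ge2$, $\mathcal{Y}_b^{(n)}$ (resp. $\mathcal{A}_b^{(n)}$) is the set of all finite convex combinations $\sum_{i=1}^k t_i\Delta_i$ with $k$ a positive integer, $t_1,\dots,t_k\in[0,1]$, $t_1+\dots+t_k=1$, and $\Delta_1,\dots,\Delta_k\in\mathcal{Y}_b^{CO(n)}$ (resp. $\in\mathcal{A}_b^{CO(n)}$). *)

theory Defs
  imports "HOL-Analysis.Analysis" "HOL-Library.Equipollence"
begin

text \<open>
  Functions \<open>[0,\<infinity>) \<rightarrow> [0,\<infinity>)\<close> are represented as functions on \<^typ>\<open>real\<close> that vanish on the
  negative half-line, so that each function on \<open>[0,\<infinity>)\<close> has exactly one representative and
  cardinalities are not affected.  For \<open>x < 0\<close> the interval \<open>{0<..<x}\<close> is empty, so the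
  integral in \<open>concave_young_density\<close> already gives \<open>\<Phi> x = 0\<close>; composition and
  convex combinations preserve this since \<open>\<Phi> 0 = 0\<close>.
\<close>

definition concave_young_density :: "(real \<Rightarrow> real) \<Rightarrow> (real \<Rightarrow> real) \<Rightarrow> bool" where
  "concave_young_density \<phi> \<Phi> \<longleftrightarrow>
     (\<forall>t>0. \<phi> t > 0) \<and>
     (\<forall>t>0. continuous (at_right t) \<phi>) \<and>
     strict_antimono_on {0<..} \<phi> \<and>
     (\<forall>x>0. set_integrable lborel {0<..<x} \<phi>) \<and>
     (\<forall>x. \<Phi> x = (LBINT t:{0<..<x}. \<phi> t)) \<and>
     filterlim \<Phi> at_top at_top"

definition Y_conc :: "(real \<Rightarrow> real) set" where
  "Y_conc = {\<Phi>. \<exists>\<phi>. concave_young_density \<phi> \<Phi>}"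

text \<open>
  The density is determined by \<open>\<Phi>\<close> on \<open>(0,\<infinity>)\<close> (it is the right derivative), so the existential
  quantifier below refers to the same \<open>\<phi>\<close> as the one witnessing \<open>\<Phi> \<in> Y_conc\<close>.
\<close>

definition A_conc :: "(real \<Rightarrow> real) set" where
  "A_conc = {\<Phi>. \<exists>\<phi>. concave_young_density \<phi> \<Phi> \<and>
                    set_integrable lborel {1<..} (\<lambda>t. \<phi> t / t)}"

definition Y_at :: "real \<Rightarrow> (real \<Rightarrow> real) set" where
  "Y_at b = {\<Phi> \<in> Y_conc. \<Phi> b = b}"

definition A_at :: "real \<Rightarrow> (real \<Rightarrow> real) set" where
  "A_at b = {\<Phi> \<in> A_conc. \<Phi> b = b}"

definition comp_list :: "('a \<Rightarrow> 'a) list \<Rightarrow> 'a \<Rightarrow> 'a" where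
  "comp_list fs = foldr (\<circ>) fs id"

definition Y_CO :: "real \<Rightarrow> nat \<Rightarrow> (real \<Rightarrow> real) set" where
  "Y_CO b n = {comp_list fs | fs. length fs = n \<and> set fs \<subseteq> Y_at b}"

definition A_CO :: "real \<Rightarrow> nat \<Rightarrow> (real \<Rightarrow> real) set" where
  "A_CO b n = {comp_list fs | fs. length fs = n \<and> set fs \<subseteq> Y_at b \<and> (\<exists>f \<in> set fs. f \<in> A_at b)}"

text \<open>
  Written out explicitly, because the function type is not an instance of
  \<^class>\<open>real_vector\<close> and \<open>convex hull\<close> is therefore unavailable.
\<close>

definition convex_combinations :: "(real \<Rightarrow> real) set \<Rightarrow> (real \<Rightarrow> real) set" where
  "convex_combinations S =
     {\<lambda>x. \<Sum>i=1..k. t i * \<Delta> i x | (k::nat) (t :: nat \<Rightarrow> real) \<Delta>.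
        k \<ge> 1 \<and> (\<forall>i\<in>{1..k}. t i \<in> {0..1} \<and> \<Delta> i \<in> S) \<and> (\<Sum>i=1..k. t i) = 1}"

text \<open>Only \<open>n \<ge> 1\<close> is meaningful below.\<close>

definition Y_level :: "real \<Rightarrow> nat \<Rightarrow> (real \<Rightarrow> real) set" where
  "Y_level b n = (if n = 1 then Y_at b else convex_combinations (Y_CO b n))"

definition A_level :: "real \<Rightarrow> nat \<Rightarrow> (real \<Rightarrow> real) set" where
  "A_level b n = (if n = 1 then A_at b else convex_combinations (A_CO b n))"

end

theory Submission
  imports Defs "HOL-Real_Asymp.Real_Asymp"
begin

text \<open>
  All five sets have the cardinality of the continuum. A continuous real function \<open>f\<close> is
  determined by the set of rational pairs \<open>(p, q)\<close> with \<open>f p < q\<close>, which gives the upper bound.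

  For the lower bound in \<open>A_level b n\<close> take the \<open>n\<close>-fold iterates of \<open>x \<mapsto> b (x / b)\<^sup>p\<close>, \<open>0 < p < 1\<close>.
  Every \<open>\<Phi>\<close> in \<open>A_conc\<close> is sublinear, since a density \<open>\<phi>\<close> bounded away from \<open>0\<close> would make
  \<open>\<integral> \<phi>(t) / t dt\<close> diverge. Functions in \<open>Y_at b\<close> are monotone and map \<open>[b, \<infinity>)\<close> into itself below
  the identity, so a composition is dominated there by each of its factors, and hence every
  element of \<open>A_level b n\<close> is sublinear. Iterating a function with asymptotic slope \<open>c \<in> (0, 1)\<close>
  yields slope \<open>c\<^sup>n > 0\<close>, which gives continuum many elements of the difference.
\<close>

section \<open>Upper bound: cardinality of the continuous real functions\<close>

lemma continuous_functions_lepoll_reals: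
  "{f :: real \<Rightarrow> real. continuous_on UNIV f} \<lesssim> (UNIV :: real set)"
proof -
  define C where "C f = {i :: nat. \<exists>p q :: rat. i = to_nat (p, q) \<and> f (of_rat p) < (of_rat q :: real)}"
    for f :: "real \<Rightarrow> real"
  have "inj_on C {f. continuous_on UNIV f}"
  proof (rule inj_onI)
    fix f g :: "real \<Rightarrow> real"
    assume fg: "f \<in> {f. continuous_on UNIV f}" "g \<in> {f. continuous_on UNIV f}" and C: "C f = C g"
    have iff: "f (of_rat p) < of_rat q \<longleftrightarrow> g (of_rat p) < of_rat q" for p q
    proof -
      have "to_nat (p, q) \<in> C f \<longleftrightarrow> to_nat (p, q) \<in> C g"
        using C by simp
      then show ?thesis by (simp add: C_def)
    qed
    have "f x = g x" if "x \<in> \<rat>" for x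
    proof (rule ccontr)
      assume "f x \<noteq> g x"
      \<comment> \<open>A rational strictly between the two values, paired with the rational
        \<open>x\<close>, would belong to only one of the codes \<open>C f\<close> and
        \<open>C g\<close>.\<close>
      then consider "f x < g x" | "g x < f x" by linarith
      then show False
        by cases (use iff \<open>x \<in> \<rat>\<close> in \<open>metis of_rat_dense Rats_cases less_asym\<close>)+
    qed
    \<comment> \<open>Agreement passes from the rationals to all reals because the agreement set of
      two continuous functions is closed.\<close>
    moreover have "closed {x. f x = g x}"
      using fg by (intro closed_Collect_eq) auto
    ultimately have "closure \<rat> \<subseteq> {x. f x = g x}"
      by (intro closure_minimal) auto
    then show "f = g"
      by (auto simp: Rats_closure_real)
  qed
  then have "{f :: real \<Rightarrow> real. continuous_on UNIV f} \<lesssim> (UNIV :: nat set set)"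
    unfolding lepoll_def by (auto intro!: exI[of _ C])
  then show ?thesis
    using nat_sets_eqpoll_reals lepoll_trans1 lepoll_trans2 by blast
qed

section \<open>Estimates for a concave Young function from its density\<close>

context
  fixes \<phi> \<Phi> :: "real \<Rightarrow> real"
  assumes dens: "concave_young_density \<phi> \<Phi>"
begin

lemma density_pos: "t > 0 \<Longrightarrow> \<phi> t > 0"
  and density_antimono: "0 < s \<Longrightarrow> s \<le> t \<Longrightarrow> \<phi> t \<le> \<phi> s"
  and density_integrable: "set_integrable lborel {0<..<x} \<phi>"
  and young_eq_integral: "\<Phi> x = (LBINT t:{0<..<x}. \<phi> t)"
  and young_at_top: "filterlim \<Phi> at_top at_top"
proof -
  show "t > 0 \<Longrightarrow> \<phi> t > 0" "\<Phi> x = (LBINT t:{0<..<x}. \<phi> t)" "filterlim \<Phi> at_top at_top"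
    using dens unfolding concave_young_density_def by blast+
  show "0 < s \<Longrightarrow> s \<le> t \<Longrightarrow> \<phi> t \<le> \<phi> s"
    using dens unfolding concave_young_density_def monotone_on_def
    by (cases "s = t") (auto intro!: less_imp_le)
  show "set_integrable lborel {0<..<x} \<phi>"
    using dens unfolding concave_young_density_def by (cases "x > 0") auto
qed

text \<open>The half-open interval complements \<open>{0<..<x}\<close> exactly inside
  \<open>{0<..<y}\<close>, so additivity applies without discarding an endpoint.\<close>

lemma young_split:
  assumes "0 < x" "x \<le> y"
  shows "set_integrable lborel {x..<y} \<phi>" "\<Phi> y = \<Phi> x + (LBINT t:{x..<y}. \<phi> t)"
proof -
  show I: "set_integrable lborel {x..<y} \<phi>"
    by (rule set_integrable_subset[OF density_integrable[of y]]) (use assms in auto)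
  have "{0<..<y} = {0<..<x} \<union> {x..<y}"
    using assms by auto
  then show "\<Phi> y = \<Phi> x + (LBINT t:{x..<y}. \<phi> t)"
    using set_integral_Un[OF _ density_integrable[of x] I] assms by (simp add: young_eq_integral ivl_disj_int)
qed

lemma young_mono:
  assumes "0 < x" "x \<le> y"
  shows "\<Phi> x \<le> \<Phi> y"
proof -
  have "(LBINT t:{x..<y}. \<phi> t) \<ge> 0"
    unfolding set_lebesgue_integral_def
    by (rule Bochner_Integration.integral_nonneg)
      (use assms in \<open>auto simp: indicator_def intro!: less_imp_le[OF density_pos]\<close>)
  then show ?thesis using young_split[OF assms] by simp
qed

text \<open>To the right of \<open>x\<close> the decreasing density is at most
  \<open>\<phi> x\<close>, so the graph stays below its right tangent at \<open>x\<close>.\<close>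

lemma young_le_tangent:
  assumes "0 < x" "x \<le> y"
  shows "\<Phi> y \<le> \<Phi> x + \<phi> x * (y - x)"
proof -
  have "(LBINT t:{x..<y}. \<phi> t) \<le> (LBINT t:{x..<y}. \<phi> x)"
    by (rule set_integral_mono)
      (use assms young_split in \<open>auto simp: set_integrable_def intro!: density_antimono\<close>)
  also have "\<dots> = \<phi> x * (y - x)"
    using assms by (simp add: set_lebesgue_integral_def)
  finally show ?thesis using young_split[OF assms] by simp
qed

text \<open>Left of \<open>x\<close> the density is at least \<open>\<phi> x\<close>; integrating
  this constant over \<open>{0<..<x}\<close> gives the bound.\<close>

lemma mult_density_le_young:
  assumes "0 < x"
  shows "x * \<phi> x \<le> \<Phi> x"
proof -
  have "(LBINT t:{0<..<x}. \<phi> x) \<le> (LBINT t:{0<..<x}. \<phi> t)"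
    by (rule set_integral_mono)
      (use assms density_integrable in \<open>auto simp: set_integrable_def intro!: density_antimono\<close>)
  moreover have "(LBINT t:{0<..<x}. \<phi> x) = x * \<phi> x"
    using assms by (simp add: set_lebesgue_integral_def)
  ultimately show ?thesis by (simp add: young_eq_integral)
qed

lemma young_continuous: "continuous_on UNIV \<Phi>"
proof -
  \<comment> \<open>Extending the density by 0 turns \<open>\<Phi>\<close> into an indefinite
    integral with a fixed lower limit \<open>-N\<close>, so negative points, 0 and positive points
    are treated alike.\<close>
  define g where "g t = (if t \<in> {0<..} then \<phi> t else 0)" for t
  have I: "set_integrable lborel {-N..x} g" "(LBINT t:{-N..x}. g t) = \<Phi> x" if "N \<ge> 0" for N x :: real
  proof -
    have "set_integrable lborel {0<..x} \<phi>"
      by (rule set_integrable_subset[OF density_integrable[of "x + 1"]]) auto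
    moreover have *: "(\<lambda>t. indicator {0<..x} t *\<^sub>R \<phi> t) = (\<lambda>t. indicator {-N..x} t *\<^sub>R g t)"
      using that by (auto simp: g_def indicator_def)
    ultimately show "set_integrable lborel {-N..x} g"
      by (simp add: set_integrable_def)
    have "(LBINT t:{-N..x}. g t) = (LBINT t:{0<..x}. \<phi> t)"
      by (simp only: set_lebesgue_integral_def *)
    \<comment> \<open>The two integrands differ at most at the single point
      \<open>x\<close>.\<close>
    also have "\<dots> = (LBINT t:{0<..<x}. \<phi> t)"
      unfolding set_lebesgue_integral_def
      by (rule integral_cong_AE)
        (use density_integrable \<open>set_integrable lborel {0<..x} \<phi>\<close> AE_lborel_singleton[of x]
          in \<open>auto simp: set_integrable_def indicator_def elim!: eventually_mono\<close>)
    finally show "(LBINT t:{-N..x}. g t) = \<Phi> x"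
      by (simp add: young_eq_integral)
  qed
  have "isCont \<Phi> x" for x
  proof -
    \<comment> \<open>This makes \<open>x\<close> an interior point of
      \<open>{-N..N}\<close>.\<close>
    define N where "N = \<bar>x\<bar> + 1"
    have "N \<ge> 0" by (simp add: N_def)
    have "continuous_on {-N..N} (\<lambda>y. integral {-N..y} g)"
      using I(1)[OF \<open>N \<ge> 0\<close>, of N]
      by (intro indefinite_integral_continuous_1 set_borel_integral_eq_integral)
    also have "(\<lambda>y. integral {-N..y} g) = \<Phi>"
      using I[OF \<open>N \<ge> 0\<close>] by (simp add: fun_eq_iff flip: set_borel_integral_eq_integral(2))
    finally show ?thesis
      by (rule continuous_on_interior) (auto simp: N_def)
  qed
  then show ?thesis by (simp add: continuous_at_imp_continuous_on)
qed

lemma young_sublinear: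
  assumes int: "set_integrable lborel {1<..} (\<lambda>t. \<phi> t / t)"
  shows "((\<lambda>x. \<Phi> x / x) \<longlongrightarrow> 0) at_top"
proof -
  have ex: "\<exists>M\<ge>1. \<phi> M < e" if "e > 0" for e
  proof (rule ccontr)
    assume "\<not> ?thesis"
    then have ge: "e \<le> \<phi> t" if "t > 1" for t using that by (meson less_imp_le not_less)
    have nn: "set_integrable lborel {1<..<x} (\<lambda>t. \<phi> t / t)" for x
      by (rule set_integrable_subset[OF int]) auto
    \<comment> \<open>If the density stays at least \<open>e\<close>, the integrand dominates
      \<open>e / t\<close> on \<open>{1<..<x}\<close>, whose integral \<open>e * ln x\<close> is
      unbounded in \<open>x\<close>; the right-hand side is a fixed real.\<close>
    have bound: "e * ln x \<le> (LBINT t:{1<..}. \<phi> t / t)" if "x > 1" for x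
    proof -
      have FTC: "set_integrable lborel (einterval 1 x) (\<lambda>t. e / t)" "(LBINT t=1..x. e / t) = e * ln x - e * ln 1"
        by (rule interval_integral_FTC_nonneg[where F = "\<lambda>t. e * ln t"];
          use \<open>e > 0\<close> \<open>x > 1\<close> in \<open>auto intro!: derivative_eq_intros continuous_intros tendsto_eq_intros
            simp: tendsto_compose_filtermap at_right_ereal at_left_ereal comp_def filterlim_filtermap one_ereal_def\<close>)+
      have "e * ln x = (LBINT t:{1<..<x}. e / t)"
        using FTC \<open>x > 1\<close> by (simp add: interval_integral_Ioo one_ereal_def)
      also have "\<dots> \<le> (LBINT t:{1<..<x}. \<phi> t / t)"
        using FTC(1) nn ge by (intro set_integral_mono divide_right_mono) (auto simp: one_ereal_def einterval_eq)
      also have "\<dots> \<le> (LBINT t:{1<..}. \<phi> t / t)"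
        using nn int unfolding set_lebesgue_integral_def set_integrable_def
        by (intro integral_mono) (auto simp: indicator_def intro!: divide_nonneg_nonneg less_imp_le[OF density_pos])
      finally show ?thesis .
    qed
    have "filterlim (\<lambda>x. e * ln x) at_top at_top"
      using \<open>e > 0\<close> by real_asymp
    then have "\<forall>\<^sub>F x in at_top. e * ln x > (LBINT t:{1<..}. \<phi> t / t)"
      by (simp add: filterlim_at_top_dense)
    from eventually_happens[OF eventually_conj[OF this eventually_gt_at_top[of 1]]]
    show False using bound by force
  qed
  show ?thesis
  proof (rule tendstoI)
    fix e :: real assume "e > 0"
    \<comment> \<open>The tangent at \<open>M\<close> has slope below \<open>e / 2\<close>, and its
      constant part contributes at most \<open>\<Phi> M / x\<close>, which is eventually below the
      other \<open>e / 2\<close>.\<close>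
    then obtain M where M: "M \<ge> 1" "\<phi> M < e / 2" using ex[of "e/2"] by auto
    have "((\<lambda>x. \<Phi> M / x) \<longlongrightarrow> 0) at_top" by real_asymp
    then have "\<forall>\<^sub>F x in at_top. \<Phi> M / x < e / 2"
      by (rule order_tendstoD) (use \<open>e > 0\<close> in simp)
    then show "\<forall>\<^sub>F x in at_top. dist (\<Phi> x / x) 0 < e"
      using eventually_ge_at_top[of M]
    proof eventually_elim
      case (elim x)
      have "x > 0" using elim M by simp
      have "0 \<le> \<Phi> x" using mult_density_le_young[OF \<open>x > 0\<close>] density_pos[OF \<open>x > 0\<close>] \<open>x > 0\<close>
        by (smt (verit) mult_pos_pos)
      have "\<Phi> x \<le> \<Phi> M + \<phi> M * (x - M)" using young_le_tangent[of M x] elim M by simp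
      also have "\<phi> M * (x - M) \<le> (e / 2) * x"
        using M elim density_pos[of M] by (intro mult_mono) auto
      finally have "\<Phi> x / x \<le> \<Phi> M / x + e / 2"
        using \<open>x > 0\<close> by (simp add: field_simps)
      also have "\<dots> < e"
        using elim by linarith
      finally show ?case using \<open>0 \<le> \<Phi> x\<close> \<open>x > 0\<close> by (simp add: dist_real_def)
    qed
  qed
qed

end


section \<open>A criterion for densities and two explicit families\<close>

text \<open>The fundamental theorem for nonnegative integrands needs only one-sided limits of the
  antiderivative at the endpoints. Integrability near 0 then follows even for densities unbounded
  there, such as those of \<open>pow_young\<close>.\<close>

lemma concave_young_densityI:
  assumes deriv: "\<And>t. t > 0 \<Longrightarrow> (\<Phi> has_real_derivative \<phi> t) (at t)"
    and cont: "\<And>t. t > 0 \<Longrightarrow> isCont \<phi> t"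
    and pos: "\<And>t. t > 0 \<Longrightarrow> \<phi> t > 0"
    and anti: "\<And>s t. 0 < s \<Longrightarrow> s < t \<Longrightarrow> \<phi> t < \<phi> s"
    and zero: "\<And>x. x \<le> 0 \<Longrightarrow> \<Phi> x = 0"
    and lim0: "(\<Phi> \<longlongrightarrow> 0) (at_right 0)"
    and top: "filterlim \<Phi> at_top at_top"
  shows "concave_young_density \<phi> \<Phi>"
proof -
  have FTC: "set_integrable lborel {0<..<x} \<phi>" "(LBINT t:{0<..<x}. \<phi> t) = \<Phi> x" if "x > 0" for x
  proof -
    have "(\<Phi> \<longlongrightarrow> \<Phi> x) (at_left x)"
      using DERIV_isCont[OF deriv[OF that]] by (simp add: filterlim_at_split isCont_def)
    then have "set_integrable lborel (einterval 0 x) \<phi>" "(LBINT t=0..x. \<phi> t) = \<Phi> x - 0"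
      using that pos lim0
      by (intro interval_integral_FTC_nonneg[where F = \<Phi>] AE_I2 impI;
          auto simp: at_right_ereal at_left_ereal comp_def filterlim_filtermap zero_ereal_def
            intro!: deriv cont less_imp_le)+
    then show "set_integrable lborel {0<..<x} \<phi>" "(LBINT t:{0<..<x}. \<phi> t) = \<Phi> x"
      using that by (simp_all add: zero_ereal_def einterval_eq interval_integral_Ioo)
  qed
  have "\<Phi> x = (LBINT t:{0<..<x}. \<phi> t)" for x
    using FTC(2)[of x] zero[of x] by (cases "x > 0") (auto simp: set_lebesgue_integral_def)
  then show ?thesis
    unfolding concave_young_density_def monotone_on_def
    using pos anti top FTC(1) by (auto intro: continuous_at_imp_continuous_at_within cont)
qed

text \<open>Since \<open>0 powr p = 0\<close>, the truncation \<open>max 0 x\<close> makes the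
  function vanish on the negative half-line. The scaling by \<open>b\<close> makes \<open>b\<close>
  a fixed point.\<close>

definition pow_young :: "real \<Rightarrow> real \<Rightarrow> real \<Rightarrow> real" where
  "pow_young b p x = b * (max 0 x / b) powr p"

text \<open>
  Has the density \<open>c + a exp (- t)\<close>, where \<open>a\<close> is chosen so that the value at \<open>b\<close> is \<open>b\<close>.
\<close>

definition lin_young :: "real \<Rightarrow> real \<Rightarrow> real \<Rightarrow> real" where
  "lin_young b c x = c * max 0 x + (1 - c) * b / (1 - exp (- b)) * (1 - exp (- max 0 x))"

lemma pow_young_in_A_at:
  assumes "b > 0" "0 < p" "p < 1"
  shows "pow_young b p \<in> A_at b"
proof -
  define \<phi> where "\<phi> t = p * (t / b) powr (p - 1)" for t
  have dens: "concave_young_density \<phi> (pow_young b p)"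
  proof (rule concave_young_densityI)
    fix t :: real assume "t > 0"
    have "((\<lambda>x. b * (x / b) powr p) has_real_derivative \<phi> t) (at t)"
      using assms \<open>t > 0\<close> by (auto intro!: derivative_eq_intros simp: \<phi>_def powr_diff field_simps)
    then show "(pow_young b p has_real_derivative \<phi> t) (at t)"
      by (rule has_field_derivative_transform_within_open[where S = "{0<..}"])
        (use \<open>t > 0\<close> in \<open>auto simp: pow_young_def\<close>)
    show "isCont \<phi> t" "\<phi> t > 0"
      using assms \<open>t > 0\<close> by (auto simp: \<phi>_def[abs_def] intro!: continuous_intros)
  next
    fix s t :: real assume "0 < s" "s < t"
    then show "\<phi> t < \<phi> s"
      using assms by (auto simp: \<phi>_def powr_less_mono2_neg divide_strict_right_mono)
  next
    show "pow_young b p x = 0" if "x \<le> 0" for x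
      using that by (simp add: pow_young_def)
    have "((\<lambda>x. b * (x / b) powr p) \<longlongrightarrow> 0) (at_right 0)"
      using assms by real_asymp
    then show "(pow_young b p \<longlongrightarrow> 0) (at_right 0)"
      by (rule Lim_transform_eventually) (auto simp: eventually_at_filter pow_young_def)
    have "filterlim (\<lambda>x. b * (x / b) powr p) at_top at_top"
      using assms by real_asymp
    then show "filterlim (pow_young b p) at_top at_top"
      by (rule filterlim_mono_eventually)
        (auto intro: eventually_mono[OF eventually_gt_at_top[of 0]] simp: pow_young_def)
  qed
  have "set_integrable lborel (einterval 1 \<infinity>) (\<lambda>t. \<phi> t / t)"
  proof (rule interval_integral_FTC_nonneg(1))
    \<comment> \<open>An antiderivative of \<open>\<phi> t / t\<close>, which is a multiple of
      \<open>t powr (p - 2)\<close>; as \<open>p < 1\<close>, it tends to 0 at infinity.\<close>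
    let ?F = "\<lambda>t. - (p / (1 - p)) * (t / b) powr (p - 1)"
    show "DERIV ?F t :> \<phi> t / t" if "1 < ereal t" "ereal t < \<infinity>" for t
    proof -
      have "t > 0" using that by (simp add: one_ereal_def)
      then have "((\<lambda>t. (t / b) powr (p - 1)) has_real_derivative
          (p - 1) * (t / b) powr (p - 1 - of_nat 1) * (1 / b)) (at t)"
        using \<open>b > 0\<close> by (intro DERIV_fun_powr DERIV_cdivide DERIV_ident) simp
      from DERIV_cmult[OF this] show ?thesis
        by (rule DERIV_cong) (use assms \<open>t > 0\<close> in \<open>simp add: \<phi>_def powr_diff power2_eq_square field_simps\<close>)
    qed
    show "isCont (\<lambda>t. \<phi> t / t) t" if "1 < ereal t" "ereal t < \<infinity>" for t
      using that assms by (auto simp: \<phi>_def one_ereal_def intro!: continuous_intros)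
    show "AE t in lborel. 1 < ereal t \<longrightarrow> ereal t < \<infinity> \<longrightarrow> 0 \<le> \<phi> t / t"
      using assms by (auto simp: \<phi>_def one_ereal_def)
    have "isCont ?F 1" using assms by (auto intro!: continuous_intros)
    then have "(?F \<longlongrightarrow> ?F 1) (at_right 1)"
      by (simp add: filterlim_at_split isCont_def)
    then show "((?F \<circ> real_of_ereal) \<longlongrightarrow> ?F 1) (at_right 1)"
      by (simp only: one_ereal_def at_right_ereal comp_def filterlim_filtermap real_of_ereal.simps)
    have "(?F \<longlongrightarrow> 0) at_top" using assms by real_asymp
    then show "((?F \<circ> real_of_ereal) \<longlongrightarrow> 0) (at_left \<infinity>)"
      by (simp only: at_left_PInf comp_def filterlim_filtermap real_of_ereal.simps)
  qed simp
  also have "einterval 1 \<infinity> = {1<..}" by (auto simp: einterval_def one_ereal_def)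
  finally show ?thesis
    using dens assms by (auto simp: A_at_def A_conc_def pow_young_def)
qed

lemma lin_young_in_Y_at:
  assumes "b > 0" "0 < c" "c < 1"
  shows "lin_young b c \<in> Y_at b"
proof -
  define a where "a = (1 - c) * b / (1 - exp (- b))"
  \<comment> \<open>Here \<open>c < 1\<close> enters: a positive \<open>a\<close> makes the density
    strictly decreasing, while \<open>c > 0\<close> gives divergence at infinity.\<close>
  have "a > 0" using assms by (simp add: a_def)
  have lin: "lin_young b c = (\<lambda>x. c * max 0 x + a * (1 - exp (- max 0 x)))"
    by (auto simp: lin_young_def a_def)
  define \<phi> where "\<phi> t = c + a * exp (- t)" for t
  have "concave_young_density \<phi> (lin_young b c)"
  proof (rule concave_young_densityI)
    fix t :: real assume "t > 0"
    have "((\<lambda>x. c * x + a * (1 - exp (- x))) has_real_derivative \<phi> t) (at t)"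
      by (auto intro!: derivative_eq_intros simp: \<phi>_def)
    then show "(lin_young b c has_real_derivative \<phi> t) (at t)"
      by (rule has_field_derivative_transform_within_open[where S = "{0<..}"])
        (use \<open>t > 0\<close> in \<open>auto simp: lin\<close>)
    show "isCont \<phi> t" "\<phi> t > 0"
      using assms \<open>a > 0\<close> by (auto simp: \<phi>_def[abs_def] intro!: continuous_intros add_pos_pos)
  next
    fix s t :: real assume "0 < s" "s < t"
    then show "\<phi> t < \<phi> s" using \<open>a > 0\<close> by (simp add: \<phi>_def)
  next
    show "lin_young b c x = 0" if "x \<le> 0" for x
      using that by (simp add: lin)
    have "((\<lambda>x. c * x + a * (1 - exp (- x))) \<longlongrightarrow> 0) (at_right 0)"
      by (auto intro!: tendsto_eq_intros)
    then show "(lin_young b c \<longlongrightarrow> 0) (at_right 0)"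
      by (rule Lim_transform_eventually) (auto simp: eventually_at_filter lin)
    have "filterlim (\<lambda>x. c * x + a * (1 - exp (- x))) at_top at_top"
      using assms by real_asymp
    then show "filterlim (lin_young b c) at_top at_top"
      by (rule filterlim_mono_eventually)
        (auto intro: eventually_mono[OF eventually_gt_at_top[of 0]] simp: lin)
  qed
  moreover have "lin_young b c b = b" using assms by (simp add: lin_young_def field_simps)
  ultimately show ?thesis by (auto simp: Y_at_def Y_conc_def)
qed

lemma lin_young_slope:
  assumes "0 < c"
  shows "((\<lambda>x. lin_young b c x / x) \<longlongrightarrow> c) at_top"
proof -
  define a where "a = (1 - c) * b / (1 - exp (- b))"
  have "((\<lambda>x. (c * x + a * (1 - exp (- x))) / x) \<longlongrightarrow> c) at_top" by real_asymp
  then show ?thesis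
    by (rule Lim_transform_eventually)
      (auto intro: eventually_mono[OF eventually_gt_at_top[of 0]] simp: lin_young_def a_def)
qed

section \<open>Iterates of the two families and bounds for compositions\<close>

lemma comp_list_Nil [simp]: "comp_list [] = id"
  and comp_list_Cons [simp]: "comp_list (f # fs) = f \<circ> comp_list fs"
  by (simp_all add: comp_list_def)

text \<open>At \<open>2 * b\<close> the normalized argument is 2, so the exponent
  \<open>p ^ n\<close>, and with it \<open>p\<close>, can be recovered from a single value of the
  iterate.\<close>

lemma comp_list_pow_young:
  assumes "b > 0"
  shows "comp_list (replicate n (pow_young b p)) (2 * b) = b * 2 powr (p ^ n)"
  by (induction n) (use assms in \<open>simp_all add: pow_young_def powr_powr mult.commute\<close>)

text \<open>Divergence of \<open>G n\<close> is carried through the induction because the outer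
  factor's slope is taken along \<open>G n x\<close>.\<close>

lemma comp_list_lin_young:
  assumes "b > 0" "0 < c" "c < 1"
  defines "G n \<equiv> comp_list (replicate n (lin_young b c))"
  shows "((\<lambda>x. G n x / x) \<longlongrightarrow> c ^ n) at_top \<and> filterlim (G n) at_top at_top"
proof (induction n)
  case 0
  have "((\<lambda>x. x / x) \<longlongrightarrow> 1) (at_top :: real filter)" by real_asymp
  then show ?case by (simp add: G_def id_def filterlim_ident)
next
  case (Suc n)
  then have G: "((\<lambda>x. G n x / x) \<longlongrightarrow> c ^ n) at_top" "filterlim (G n) at_top at_top" by auto
  have "filterlim (lin_young b c) at_top at_top"
    using lin_young_in_Y_at[OF assms(1-3)] young_at_top by (auto simp: Y_at_def Y_conc_def)
  then have "filterlim (G (Suc n)) at_top at_top"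
    using G(2) by (simp add: G_def comp_def filterlim_compose)
  \<comment> \<open>Asymptotic slopes multiply under composition; \<open>G n x\<close> cancels as
    soon as it is positive, hence eventually.\<close>
  moreover have "((\<lambda>x. (lin_young b c (G n x) / G n x) * (G n x / x)) \<longlongrightarrow> c * c ^ n) at_top"
    by (intro tendsto_mult G filterlim_compose[OF lin_young_slope[OF \<open>0 < c\<close>]])
  then have "((\<lambda>x. G (Suc n) x / x) \<longlongrightarrow> c * c ^ n) at_top"
    by (rule Lim_transform_eventually)
      (use G(2) in \<open>auto simp: G_def filterlim_at_top_dense elim!: eventually_mono[OF spec[of _ 0]]\<close>)
  ultimately show ?case by simp
qed

lemma Y_at_bounds:
  assumes "\<Phi> \<in> Y_at b" "b > 0"
  shows "b \<le> x \<Longrightarrow> b \<le> \<Phi> x" "b \<le> x \<Longrightarrow> \<Phi> x \<le> x" "b \<le> x \<Longrightarrow> x \<le> y \<Longrightarrow> \<Phi> x \<le> \<Phi> y"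
proof -
  obtain \<phi> where \<phi>: "concave_young_density \<phi> \<Phi>" and b: "\<Phi> b = b"
    using assms by (auto simp: Y_at_def Y_conc_def)
  show "b \<le> x \<Longrightarrow> b \<le> \<Phi> x" "b \<le> x \<Longrightarrow> x \<le> y \<Longrightarrow> \<Phi> x \<le> \<Phi> y"
    using young_mono[OF \<phi>, of b x] young_mono[OF \<phi>, of x y] b \<open>b > 0\<close> by auto
  assume "b \<le> x"
  \<comment> \<open>From \<open>b * \<phi> b \<le> \<Phi> b = b\<close>. The tangent at the fixed
    point \<open>b\<close> then lies below the identity on the right of \<open>b\<close>.\<close>
  have "\<phi> b \<le> 1"
    using mult_density_le_young[OF \<phi> \<open>b > 0\<close>] b \<open>b > 0\<close> by simp
  then have "\<phi> b * (x - b) \<le> 1 * (x - b)"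
    using \<open>b \<le> x\<close> by (intro mult_right_mono) auto
  then show "\<Phi> x \<le> x"
    using young_le_tangent[OF \<phi> \<open>b > 0\<close> \<open>b \<le> x\<close>] b by simp
qed

lemma comp_list_bounds:
  assumes "set fs \<subseteq> Y_at b" "b > 0" "b \<le> x"
  shows "b \<le> comp_list fs x \<and> comp_list fs x \<le> x \<and> (\<forall>f\<in>set fs. comp_list fs x \<le> f x)"
  using assms(1)
proof (induction fs)
  case (Cons g fs)
  let ?y = "comp_list fs x"
  have g: "g \<in> Y_at b" and y: "b \<le> ?y" "?y \<le> x" "\<forall>f\<in>set fs. ?y \<le> f x"
    using Cons by auto
  \<comment> \<open>The second inequality passes on the bounds by the inner factors; the third, by
    monotonicity of \<open>g\<close> and \<open>?y \<le> x\<close>, gives the bound by the new outer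
    factor.\<close>
  have "b \<le> g ?y" "g ?y \<le> ?y" "g ?y \<le> g x"
    using Y_at_bounds[OF g \<open>b > 0\<close>] y by blast+
  with y show ?case
    by (auto intro: order_trans)
qed (use assms in auto)

section \<open>Convex combinations, sublinearity and continuity of the levels\<close>

lemma A_at_subset_Y_at: "A_at b \<subseteq> Y_at b"
  and A_at_subset_A_conc: "A_at b \<subseteq> A_conc"
  and A_conc_subset_Y_conc: "A_conc \<subseteq> Y_conc"
  by (auto simp: A_at_def Y_at_def A_conc_def Y_conc_def)

lemma convex_combinations_mono: "S \<subseteq> T \<Longrightarrow> convex_combinations S \<subseteq> convex_combinations T"
  unfolding convex_combinations_def by blast

lemma subset_convex_combinations: "S \<subseteq> convex_combinations S"
proof
  fix f assume "f \<in> S"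
  have "\<exists>(k::nat) t \<Delta>. f = (\<lambda>x. \<Sum>i=1..k. t i * \<Delta> i x) \<and> k \<ge> 1 \<and>
      (\<forall>i\<in>{1..k}. t i \<in> {0..1} \<and> \<Delta> i \<in> S) \<and> (\<Sum>i=1..k. t i) = (1::real)"
    using \<open>f \<in> S\<close> by (intro exI[of _ "1::nat"] exI[of _ "\<lambda>_. 1::real"] exI[of _ "\<lambda>_. f"]) auto
  then show "f \<in> convex_combinations S"
    unfolding convex_combinations_def by blast
qed

lemma convex_combinations_tendsto_0:
  assumes "\<And>f. f \<in> S \<Longrightarrow> ((\<lambda>x. f x / x) \<longlongrightarrow> 0) at_top" "g \<in> convex_combinations S"
  shows "((\<lambda>x. g x / x) \<longlongrightarrow> 0) at_top"
proof -
  obtain k t \<Delta> where g: "g = (\<lambda>x. \<Sum>i=1..k::nat. t i * \<Delta> i x)" "\<forall>i\<in>{1..k}. \<Delta> i \<in> S"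
    using assms(2) unfolding convex_combinations_def by blast
  have "((\<lambda>x. \<Sum>i=1..k. t i * (\<Delta> i x / x)) \<longlongrightarrow> (\<Sum>i=1..k. t i * 0)) at_top"
    using g assms(1) by (intro tendsto_intros) auto
  then show ?thesis
    by (simp add: g(1) sum_divide_distrib)
qed

lemma convex_combinations_continuous:
  assumes "\<And>f. f \<in> S \<Longrightarrow> continuous_on UNIV f" "g \<in> convex_combinations S"
  shows "continuous_on UNIV g"
proof -
  obtain k t \<Delta> where g: "g = (\<lambda>x. \<Sum>i=1..k::nat. t i * \<Delta> i x)" "\<forall>i\<in>{1..k}. \<Delta> i \<in> S"
    using assms(2) unfolding convex_combinations_def by blast
  show ?thesis
    unfolding g(1) using g(2) assms(1) by (intro continuous_intros) auto
qed

lemma Y_conc_continuous: "\<Phi> \<in> Y_conc \<Longrightarrow> continuous_on UNIV \<Phi>"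
  by (auto simp: Y_conc_def young_continuous)

lemma A_conc_sublinear: "\<Phi> \<in> A_conc \<Longrightarrow> ((\<lambda>x. \<Phi> x / x) \<longlongrightarrow> 0) at_top"
  by (auto simp: A_conc_def young_sublinear)

lemma A_CO_sublinear:
  assumes "f \<in> A_CO b n" "b > 0"
  shows "((\<lambda>x. f x / x) \<longlongrightarrow> 0) at_top"
proof -
  obtain fs \<Phi> where f: "f = comp_list fs" and fs: "set fs \<subseteq> Y_at b" "\<Phi> \<in> set fs" "\<Phi> \<in> A_at b"
    using assms by (auto simp: A_CO_def)
  have "((\<lambda>x. \<Phi> x / x) \<longlongrightarrow> 0) at_top"
    using fs(3) A_at_subset_A_conc A_conc_sublinear by blast
  \<comment> \<open>Whatever the position of the sublinear factor \<open>\<Phi>\<close>, it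
    dominates the whole composition on \<open>[b, \<infinity>)\<close>.\<close>
  moreover have "\<forall>\<^sub>F x in at_top. 0 \<le> f x / x \<and> f x / x \<le> \<Phi> x / x"
    using eventually_ge_at_top[of b]
  proof eventually_elim
    case (elim x)
    then show ?case
      using comp_list_bounds[OF fs(1) \<open>b > 0\<close> elim] fs(2) \<open>b > 0\<close>
      by (auto simp: f intro!: divide_right_mono)
  qed
  ultimately show ?thesis
    by (intro tendsto_sandwich[of "\<lambda>_. 0" "\<lambda>x. f x / x" at_top "\<lambda>x. \<Phi> x / x" 0])
      (auto elim: eventually_mono)
qed

lemma A_level_sublinear:
  assumes "f \<in> A_level b n" "b > 0"
  shows "((\<lambda>x. f x / x) \<longlongrightarrow> 0) at_top"
  using assms convex_combinations_tendsto_0[OF A_CO_sublinear] A_conc_sublinear A_at_subset_A_conc[of b]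
  by (auto simp: A_level_def split: if_splits)

lemma Y_CO_continuous: "f \<in> Y_CO b n \<Longrightarrow> continuous_on UNIV f"
proof -
  have "continuous_on UNIV (comp_list fs)" if "set fs \<subseteq> Y_at b" for fs
    using that
  proof (induction fs)
    case (Cons g fs)
    then have "continuous_on UNIV g" "continuous_on UNIV (comp_list fs)"
      using Y_conc_continuous by (auto simp: Y_at_def)
    then show ?case
      using continuous_on_compose2[of UNIV g UNIV "comp_list fs"] by (simp add: comp_def)
  qed (simp add: id_def)
  then show "f \<in> Y_CO b n \<Longrightarrow> continuous_on UNIV f"
    by (auto simp: Y_CO_def)
qed

lemma Y_level_continuous: "f \<in> Y_level b n \<Longrightarrow> continuous_on UNIV f"
  using convex_combinations_continuous[of "Y_CO b n" f] Y_CO_continuous Y_conc_continuous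
  by (auto simp: Y_level_def Y_at_def split: if_splits)

text \<open>Level 1 is defined without convex combinations; viewing it as compositions of length one
  lets the iterates serve every level uniformly.\<close>

lemma Y_CO_1: "Y_CO b 1 = Y_at b"
  and A_CO_1: "A_CO b 1 = A_at b"
proof -
  have *: "{comp_list fs | fs. length fs = 1 \<and> P fs} = {f. P [f]}" for P :: "(real \<Rightarrow> real) list \<Rightarrow> bool"
    by (force simp: length_Suc_conv)
  show "Y_CO b 1 = Y_at b" "A_CO b 1 = A_at b"
    unfolding Y_CO_def A_CO_def * using A_at_subset_Y_at[of b] by auto
qed

lemma Y_CO_subset_Y_level: "Y_CO b n \<subseteq> Y_level b n"
  and A_CO_subset_A_level: "A_CO b n \<subseteq> A_level b n"
  using subset_convex_combinations Y_CO_1 A_CO_1 by (auto simp: Y_level_def A_level_def)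

lemma A_level_subset_Y_level: "A_level b n \<subseteq> Y_level b n"
  using convex_combinations_mono[of "A_CO b n" "Y_CO b n"] A_at_subset_Y_at
  by (auto simp: Y_level_def A_level_def A_CO_def Y_CO_def)

section \<open>Lower bounds and the final comparison\<close>

lemma reals_lepollI:
  assumes "inj_on F {0<..<1::real}" "F ` {0<..<1} \<subseteq> S"
  shows "(UNIV :: real set) \<lesssim> S"
proof -
  have "{0<..<1::real} \<lesssim> S" using assms by (auto simp: lepoll_def)
  moreover have "{0<..<1::real} \<approx> (UNIV :: real set)"
    by (simp add: open_interval_eqpoll_reals)
  ultimately show ?thesis
    by (meson eqpoll_sym lepoll_trans1)
qed

lemma reals_lepoll_A_level:
  assumes "n \<ge> 1" "b > 0"
  shows "(UNIV :: real set) \<lesssim> A_level b n"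
proof (rule reals_lepollI)
  let ?F = "\<lambda>p. comp_list (replicate n (pow_young b p))"
  show "inj_on ?F {0<..<1}"
  proof (rule inj_onI)
    fix p q assume pq: "p \<in> {0<..<1}" "q \<in> {0<..<1}" and "?F p = ?F q"
    then have "b * 2 powr (p ^ n) = b * 2 powr (q ^ n)"
      using comp_list_pow_young[OF \<open>b > 0\<close>, of n] by metis
    then have "p ^ n = q ^ n" using \<open>b > 0\<close> by (simp add: powr_inj)
    then show "p = q" using pq \<open>n \<ge> 1\<close> by (auto simp: power_eq_iff_eq_base)
  qed
  have "?F p \<in> A_CO b n" if "p \<in> {0<..<1}" for p
    using pow_young_in_A_at[OF \<open>b > 0\<close>, of p] that A_at_subset_Y_at[of b] \<open>n \<ge> 1\<close>
    unfolding A_CO_def by (intro CollectI exI[of _ "replicate n (pow_young b p)"]) auto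
  then show "?F ` {0<..<1} \<subseteq> A_level b n"
    using A_CO_subset_A_level by blast
qed

text \<open>The limit slope \<open>c ^ n\<close> does double duty: it determines \<open>c\<close>,
  giving injectivity, and being nonzero it excludes the iterate from the sublinear
  \<open>A_level b n\<close>.\<close>

lemma reals_lepoll_diff_level:
  assumes "n \<ge> 1" "b > 0"
  shows "(UNIV :: real set) \<lesssim> Y_level b n - A_level b n"
proof (rule reals_lepollI)
  let ?F = "\<lambda>c. comp_list (replicate n (lin_young b c))"
  have lim: "((\<lambda>x. ?F c x / x) \<longlongrightarrow> c ^ n) at_top" if "c \<in> {0<..<1}" for c
    using comp_list_lin_young[OF \<open>b > 0\<close>, of c n] that by auto
  show "inj_on ?F {0<..<1}"
  proof (rule inj_onI)
    fix c d assume cd: "c \<in> {0<..<1}" "d \<in> {0<..<1}" and eq: "?F c = ?F d"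
    have "c ^ n = d ^ n"
      using lim[OF cd(1)] lim[OF cd(2)] unfolding eq
      by (rule tendsto_unique[OF trivial_limit_at_top_linorder])
    then show "c = d" using cd \<open>n \<ge> 1\<close> by (auto simp: power_eq_iff_eq_base)
  qed
  have "?F c \<in> Y_level b n - A_level b n" if "c \<in> {0<..<1}" for c
  proof
    have "?F c \<in> Y_CO b n"
      using lin_young_in_Y_at[OF \<open>b > 0\<close>, of c] that
      unfolding Y_CO_def by (intro CollectI exI[of _ "replicate n (lin_young b c)"]) auto
    then show "?F c \<in> Y_level b n" using Y_CO_subset_Y_level by blast
    show "?F c \<notin> A_level b n"
    proof
      assume "?F c \<in> A_level b n"
      from A_level_sublinear[OF this \<open>b > 0\<close>] have "c ^ n = 0"
        using lim[OF that] tendsto_unique[OF trivial_limit_at_top_linorder] by blast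
      then show False using that by simp
    qed
  qed
  then show "?F ` {0<..<1} \<subseteq> Y_level b n - A_level b n" by blast
qed

theorem corollary2:
  fixes n :: nat and b :: real
  assumes "n \<ge> 1" and "b > 0"
  shows "\<forall>S \<in> {Y_level b n, A_level b n, Y_level b n - A_level b n, A_conc, Y_conc}.
         \<forall>T \<in> {Y_level b n, A_level b n, Y_level b n - A_level b n, A_conc, Y_conc}. S \<approx> T"
proof -
  let ?C = "{f :: real \<Rightarrow> real. continuous_on UNIV f}"
  \<comment> \<open>Schroeder-Bernstein: any set of continuous functions containing a
    continuum-sized subset has the cardinality of the reals.\<close>
  have between: "S \<approx> (UNIV :: real set)"
    if "(UNIV :: real set) \<lesssim> S'" "S' \<subseteq> S" "S \<subseteq> ?C" for S S'
    using that continuous_functions_lepoll_reals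
    by (meson lepoll_antisym lepoll_trans subset_imp_lepoll)
  note A = between[OF reals_lepoll_A_level[OF assms]]
  note D = between[OF reals_lepoll_diff_level[OF assms]]
  \<comment> \<open>\<open>A_conc\<close> and \<open>Y_conc\<close> do not depend on
    \<open>n\<close>; their lower bound comes from level 1, where the iterates are the power
    functions themselves.\<close>
  have "A_level b 1 \<subseteq> A_conc"
    by (simp add: A_level_def A_at_subset_A_conc)
  note B = between[OF lepoll_trans[OF reals_lepoll_A_level[OF order_refl \<open>b > 0\<close>] subset_imp_lepoll[OF this]]]
  have Y: "Y_level b n \<subseteq> ?C" "Y_conc \<subseteq> ?C"
    using Y_level_continuous Y_conc_continuous by auto
  have "Y_level b n \<approx> (UNIV :: real set)" "A_level b n \<approx> (UNIV :: real set)"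
    using Y A_level_subset_Y_level[of b n] by (auto intro!: A)
  moreover have "Y_level b n - A_level b n \<approx> (UNIV :: real set)"
    using Y by (intro D) auto
  moreover have "A_conc \<approx> (UNIV :: real set)" "Y_conc \<approx> (UNIV :: real set)"
    using Y A_conc_subset_Y_conc by (auto intro!: B)
  ultimately have "\<forall>S \<in> {Y_level b n, A_level b n, Y_level b n - A_level b n, A_conc, Y_conc}.
      S \<approx> (UNIV :: real set)"
    by simp
  then show ?thesis
    by (meson eqpoll_sym eqpoll_trans)
qed

end
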